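(* Let $(\Omega,\mathcal A,\mathbb A=(\mathcal A_t)_{t\le T},R)$ be a standard filtered probability space and let $(A_t)_{t\in[0,T]}$ and $(B_t)_{t\in[0,T]}$ be two non-negative increasing predictable processes. Assume that the associated kernels $dA$ and $dB$ are mutually singular. Then there exists a predictable random set $C^A$ such that, $R$-a.s., $C^{A,\omega}$ and $\overline{C^{A,\omega}}$ are disjoint supports of the measures $dA(\omega,\cdot)$ and $dB(\omega,\cdot)$, respectively.
   Context: A support of a measure $\mu$ on $(E,\mathcal E)$ is any $C\in\mathcal E$ with $\mu(E\setminus C)=0$. A random set is a subset of $\Omega\times[0,T]$; it is measurable if it belongs to $\mathcal A\otimes\mathcal B([0,T])$ and predictable if it belongs to the predictable $\sigma$-algebra $\mathcal P(\mathbb A)$. For a random set $C$, $\overline C$ is its complement and $C^\omega=\{t:(\omega,t)\in C\}$ its $\omega$-section; $C^{A,\omega}$ is the $\omega$-section of $C^A$ and $\overline{C^{A,\omega}}=[0,T]\setminus C^{A,\omega}$. An increasing process $V$ defines the kernel $dV:\Omega\times\mathcal B([0,T])\to\mathbb R^+$, $dV(\omega,G)=\int_G dV_s(\omega)$. Two kernels $\kappa^1,\kappa^2$ from $\Omega$ to $[0,T]$ are mutually singular if there exist two disjoint measurable random sets $\Gamma_1,\Gamma_2$ with $\kappa^i(\omega,\overline{\Gamma_i^\omega})=0$, $i=1,2$. Standard filtration: right-continuous and complete. *)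

theory Defs
  imports "HOL-Probability.Probability"
begin

text \<open>
  The library locale \<open>filtration\<close> is indexed by a whole type; here time runs over the interval
  \<open>{0..T}\<close>, and nothing is assumed about \<open>F t\<close> for other \<open>t\<close>.
\<close>

locale standard_filtered_prob_space = prob_space R + complete_measure R
  for R :: "'a measure" and T :: real and F :: "real \<Rightarrow> 'a measure" +
  assumes T_nonneg: "0 \<le> T"
    and subalgebra_F: "\<And>t. t \<in> {0..T} \<Longrightarrow> subalgebra R (F t)"
    and mono_F: "\<And>s t. 0 \<le> s \<Longrightarrow> s \<le> t \<Longrightarrow> t \<le> T \<Longrightarrow> sets (F s) \<subseteq> sets (F t)"
    and right_continuous_F: "\<And>t. t \<in> {0..<T} \<Longrightarrow> sets (F t) = (\<Inter>s\<in>{t<..T}. sets (F s))"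
    and complete_F: "null_sets R \<subseteq> sets (F 0)"

definition predictable_algebra :: "real \<Rightarrow> (real \<Rightarrow> 'a measure) \<Rightarrow> ('a \<times> real) measure" where
  "predictable_algebra T F = sigma (space (F 0) \<times> {0..T})
     ({E \<times> {0} | E. E \<in> sets (F 0)} \<union>
      {E \<times> {s<..t} | E s t. 0 \<le> s \<and> s < t \<and> t \<le> T \<and> E \<in> sets (F s)})"

definition predictable_process ::
    "real \<Rightarrow> (real \<Rightarrow> 'a measure) \<Rightarrow> (real \<Rightarrow> 'a \<Rightarrow> real) \<Rightarrow> bool" where
  "predictable_process T F V \<longleftrightarrow> (\<lambda>(\<omega>, t). V t \<omega>) \<in> borel_measurable (predictable_algebra T F)"

text \<open>
  As usual, increasing means that the paths are nondecreasing and right-continuous, so that they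
  are the distribution functions of measures.
\<close>

definition increasing_paths :: "'a measure \<Rightarrow> real \<Rightarrow> (real \<Rightarrow> 'a \<Rightarrow> real) \<Rightarrow> bool" where
  "increasing_paths R T V \<longleftrightarrow> (\<forall>\<omega>\<in>space R.
     mono_on {0..T} (\<lambda>t. V t \<omega>) \<and>
     (\<forall>t\<in>{0..<T}. continuous (at_right t) (\<lambda>s. V s \<omega>)))"

definition nonneg_process :: "'a measure \<Rightarrow> real \<Rightarrow> (real \<Rightarrow> 'a \<Rightarrow> real) \<Rightarrow> bool" where
  "nonneg_process R T V \<longleftrightarrow> (\<forall>\<omega>\<in>space R. \<forall>t\<in>{0..T}. 0 \<le> V t \<omega>)"

text \<open>
  The Lebesgue--Stieltjes kernel \<open>dV\<close>, a measure on the Borel sets of \<open>{0..T}\<close> for every \<open>\<omega>\<close>, with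
  the convention \<open>V\<^bsub>0-\<^esub> = 0\<close>: the measure of \<open>{0..t}\<close> is \<open>V t \<omega>\<close>, so that \<open>{0}\<close> has mass \<open>V 0 \<omega>\<close>.
  The convention without mass at \<open>0\<close> is the case of the process \<open>V t \<omega> - V 0 \<omega>\<close>.
\<close>

definition stieltjes_kernel :: "real \<Rightarrow> (real \<Rightarrow> 'a \<Rightarrow> real) \<Rightarrow> 'a \<Rightarrow> real measure" where
  "stieltjes_kernel T V \<omega> =
     restrict_space (interval_measure (\<lambda>t. if t < 0 then 0 else V (min t T) \<omega>)) {0..T}"

definition sect :: "('a \<times> 'b) set \<Rightarrow> 'a \<Rightarrow> 'b set" where
  "sect C \<omega> = {t. (\<omega>, t) \<in> C}"

definition is_support :: "'b measure \<Rightarrow> 'b set \<Rightarrow> bool" where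
  "is_support M C \<longleftrightarrow> C \<in> sets M \<and> emeasure M (space M - C) = 0"

definition mutually_singular_kernels ::
    "'a measure \<Rightarrow> 'b measure \<Rightarrow> ('a \<Rightarrow> 'b measure) \<Rightarrow> ('a \<Rightarrow> 'b measure) \<Rightarrow> bool" where
  "mutually_singular_kernels M N \<kappa>1 \<kappa>2 \<longleftrightarrow>
     (\<exists>\<Gamma>1 \<in> sets (M \<Otimes>\<^sub>M N). \<exists>\<Gamma>2 \<in> sets (M \<Otimes>\<^sub>M N). \<Gamma>1 \<inter> \<Gamma>2 = {} \<and>
       (\<forall>\<omega>\<in>space M. emeasure (\<kappa>1 \<omega>) (space N - sect \<Gamma>1 \<omega>) = 0 \<and>
                     emeasure (\<kappa>2 \<omega>) (space N - sect \<Gamma>2 \<omega>) = 0))"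

end

theory Submission imports Defs begin

text \<open>
  Mutual singularity only provides sets in \<open>\<A> \<otimes> \<B>([0,T])\<close>; the task is to replace them by a
  predictable one. This is done by differentiating \<open>dA\<close> against \<open>dB\<close> one path at a time, looking only
  to the left. Let \<open>C\<close> consist of the \<open>(\<omega>, t)\<close> such that there are rational \<open>s < t\<close> arbitrarily close
  to \<open>t\<close> with \<open>dA(\<omega>, (s,t]) > dB(\<omega>, (s,t])\<close>, where paths are extended by \<open>0\<close> to negative times.

  The set \<open>C\<close> is predictable: the inequality says that \<open>Y = A - B\<close> satisfies \<open>Y\<^sub>s < Y\<^sub>t\<close>, which involves
  the predictable process \<open>Y\<close> at time \<open>t\<close> and an \<open>\<A>\<^sub>s\<close>-measurable variable for some rational \<open>s < t\<close>
  (\<open>left_rise_set_predictable\<close>). Difference quotients over intervals that extend to the right of \<open>t\<close>,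
  such as those of a dyadic partition, would look into the future.

  The set \<open>C\<close> separates the two kernels because of a one-sided differentiation theorem: if \<open>\<nu>(E) = 0\<close>
  and every \<open>t \<in> E\<close> is the right end of arbitrarily short intervals with
  \<open>\<mu>((s,t]) \<le> \<nu>((s,t])\<close>, then \<open>\<mu>(E) = 0\<close> (\<open>null_if_left_dominated\<close>). Let \<open>\<Gamma>\<^sub>1\<close> and \<open>\<Gamma>\<^sub>2\<close> carry \<open>dA\<close>
  and \<open>dB\<close>. On \<open>\<Gamma>\<^sub>1 - C\<close>, which is \<open>dB\<close>-null, the hypothesis holds with \<open>\<mu> = dA\<close>, \<open>\<nu> = dB\<close>, and on
  \<open>\<Gamma>\<^sub>2 \<inter> C\<close>, which is \<open>dA\<close>-null, it holds with the roles exchanged. Hence \<open>C\<close> carries \<open>dA\<close> and its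
  complement carries \<open>dB\<close>, and this for every \<open>\<omega>\<close>, not only almost every one.
\<close>

section \<open>One-sided differentiation of measures on the line\<close>

text \<open>
  The intervals \<open>(s,t]\<close> with right end in \<open>K\<close> need not be disjoint, but \<open>K\<close> can be exhausted from the
  right by disjoint ones, up to limits. Instead of a transfinite recursion, consider the set \<open>S\<close> of
  those \<open>x\<close> for which the estimate holds on \<open>(x,\<infinity>)\<close>. It is closed under limits from the right. It
  extends to the left through every gap of \<open>K\<close>, where \<open>\<mu>(K \<inter> (x,\<infinity>))\<close> does not change, and from every
  point of \<open>K\<close>, by the interval given there. So it contains points below all of \<open>K\<close>.
\<close>

lemma compact_left_dominated_le:
  fixes \<mu> \<nu> :: "real measure"
  assumes sets: "sets \<mu> = sets borel" "sets \<nu> = sets borel"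
    and K: "compact K" and U: "U \<in> sets borel"
    and dom: "\<And>t. t \<in> K \<Longrightarrow> \<exists>s<t. {s<..t} \<subseteq> U \<and> emeasure \<mu> {s<..t} \<le> emeasure \<nu> {s<..t}"
  shows "emeasure \<mu> K \<le> emeasure \<nu> U"
proof (cases "K = {}")
  case False
  define S where "S = {x. emeasure \<mu> (K \<inter> {x<..}) \<le> emeasure \<nu> (U \<inter> {x<..})}"
  note meas = sets U borel_compact[OF K]
  obtain a where a: "a \<in> K" "\<And>x. x \<in> K \<Longrightarrow> a \<le> x"
    using compact_attains_inf[OF K False] by blast
  obtain b where b: "b \<in> K" "\<And>x. x \<in> K \<Longrightarrow> x \<le> b"
    using compact_attains_sup[OF K False] by blast
  have gap: "y \<in> S" if "x \<in> S" "y \<le> x" "K \<inter> {y<..x} = {}" for x y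
  proof -
    have "K \<inter> {y<..} = K \<inter> {x<..}"
      using that(2,3) by force
    also have "emeasure \<mu> \<dots> \<le> emeasure \<nu> (U \<inter> {x<..})"
      using that(1) by (simp add: S_def)
    also have "\<dots> \<le> emeasure \<nu> (U \<inter> {y<..})"
      using that(2) meas by (intro emeasure_mono) auto
    finally show ?thesis by (simp add: S_def)
  qed
  have jump: "\<exists>s<t. s \<in> S" if t: "t \<in> S" "t \<in> K" for t
  proof -
    obtain s where s: "s < t" "{s<..t} \<subseteq> U" "emeasure \<mu> {s<..t} \<le> emeasure \<nu> {s<..t}"
      using dom[OF t(2)] by blast
    have "emeasure \<mu> (K \<inter> {s<..}) \<le> emeasure \<mu> ({s<..t} \<union> (K \<inter> {t<..}))"
      using meas by (intro emeasure_mono) auto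
    also have "\<dots> \<le> emeasure \<mu> {s<..t} + emeasure \<mu> (K \<inter> {t<..})"
      using meas by (intro emeasure_subadditive) auto
    also have "\<dots> \<le> emeasure \<nu> {s<..t} + emeasure \<nu> (U \<inter> {t<..})"
      using s(3) t(1) by (intro add_mono) (auto simp: S_def)
    also have "\<dots> = emeasure \<nu> ({s<..t} \<union> (U \<inter> {t<..}))"
      using meas by (intro plus_emeasure) auto
    also have "{s<..t} \<union> (U \<inter> {t<..}) = U \<inter> {s<..}"
      using s(1,2) by force
    finally show ?thesis using s(1) by (auto simp: S_def)
  qed
  have "b \<in> S"
  proof -
    have "K \<inter> {b<..} = {}" using b(2) by force
    then show ?thesis by (simp add: S_def)
  qed
  have "\<exists>s\<in>S. s < a"
  proof (rule ccontr)
    assume "\<not> (\<exists>s\<in>S. s < a)"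
    then have lower: "a \<le> s" if "s \<in> S" for s using that by force
    then have bdd: "bdd_below S" by (rule bdd_belowI)
    define x where "x = Inf S"
    have x_le: "x \<le> s" if "s \<in> S" for s
      unfolding x_def using bdd that by (intro cInf_lower)
    have "a \<le> x"
      unfolding x_def using \<open>b \<in> S\<close> lower by (intro cInf_greatest) auto
    have "x \<in> S"
    proof -
      have Un: "(\<Union>n. K \<inter> {x + 1 / Suc n<..}) = K \<inter> {x<..}"
      proof (intro subset_antisym subsetI)
        fix y assume y: "y \<in> K \<inter> {x<..}"
        then obtain n where "1 / Suc n < y - x"
          using nat_approx_posE[of "y - x"] by auto
        then show "y \<in> (\<Union>n. K \<inter> {x + 1 / Suc n<..})"
          using y by (auto intro!: exI[of _ n])
      next
        fix y assume "y \<in> (\<Union>n. K \<inter> {x + 1 / Suc n<..})"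
        then obtain n where "y \<in> K" "x + 1 / Suc n < y" by auto
        moreover have "0 < 1 / real (Suc n)" by simp
        ultimately have "x < y" by linarith
        then show "y \<in> K \<inter> {x<..}" using \<open>y \<in> K\<close> by simp
      qed
      have "incseq (\<lambda>n. K \<inter> {x + 1 / Suc n<..})"
      proof (rule incseq_SucI)
        fix n
        have "1 / real (Suc (Suc n)) \<le> 1 / real (Suc n)"
          by (simp add: field_simps)
        then show "K \<inter> {x + 1 / Suc n<..} \<subseteq> K \<inter> {x + 1 / Suc (Suc n)<..}"
          by auto
      qed
      moreover have tails: "K \<inter> {c<..} \<in> sets \<mu>" for c
        using meas by auto
      ultimately have "emeasure \<mu> (K \<inter> {x<..}) = (SUP n. emeasure \<mu> (K \<inter> {x + 1 / Suc n<..}))"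
        unfolding Un[symmetric] by (intro SUP_emeasure_incseq[symmetric] image_subsetI tails)
      also have "\<dots> \<le> emeasure \<nu> (U \<inter> {x<..})"
      proof (rule SUP_least)
        fix n
        have "Inf S < x + 1 / Suc n" by (simp add: x_def)
        then obtain s where s: "s \<in> S" "s < x + 1 / Suc n"
          using cInf_lessD[of S "x + 1 / Suc n"] \<open>b \<in> S\<close> by auto
        have "emeasure \<mu> (K \<inter> {x + 1 / Suc n<..}) \<le> emeasure \<mu> (K \<inter> {s<..})"
          using s(2) meas by (intro emeasure_mono) auto
        also have "\<dots> \<le> emeasure \<nu> (U \<inter> {s<..})"
          using s(1) by (simp add: S_def)
        also have "\<dots> \<le> emeasure \<nu> (U \<inter> {x<..})"
          using x_le[OF s(1)] meas by (intro emeasure_mono) auto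
        finally show "emeasure \<mu> (K \<inter> {x + 1 / Suc n<..}) \<le> emeasure \<nu> (U \<inter> {x<..})" .
      qed
      finally show ?thesis by (simp add: S_def)
    qed
    \<comment> \<open>Compactness enters here: the last point \<open>y\<close> of \<open>K\<close> up to \<open>x\<close> is attained. As \<open>K\<close> has no
      point in \<open>(y,x]\<close>, the minimality of \<open>x\<close> yields \<open>y = x\<close>.\<close>
    have "compact (K \<inter> {..x})" "K \<inter> {..x} \<noteq> {}"
      using K a(1) \<open>a \<le> x\<close> by (auto intro: compact_Int_closed)
    then obtain y where y: "y \<in> K" "y \<le> x" "\<And>z. z \<in> K \<Longrightarrow> z \<le> x \<Longrightarrow> z \<le> y"
      using compact_attains_sup[of "K \<inter> {..x}"] by auto
    have "y \<in> S"
      using \<open>x \<in> S\<close> y(2) by (rule gap) (use y(3) in force)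
    then have "x \<in> K"
      using x_le y(1,2) by force
    then show False
      using jump[OF \<open>x \<in> S\<close>] x_le by force
  qed
  then obtain s where s: "s \<in> S" "s < a" by blast
  then have "K = K \<inter> {s<..}" using a(2) by force
  then have "emeasure \<mu> K \<le> emeasure \<nu> (U \<inter> {s<..})"
    using s(1) by (simp add: S_def)
  also have "\<dots> \<le> emeasure \<nu> U"
    using meas by (intro emeasure_mono) auto
  finally show ?thesis .
qed simp

text \<open>
  Inner regularity of \<open>\<mu>\<close> reduces the claim to compact \<open>K \<subseteq> E\<close>, and outer regularity of \<open>\<nu>\<close> provides
  open \<open>U \<supseteq> E\<close> of small \<open>\<nu>\<close>-measure; the dominated intervals can be chosen inside \<open>U\<close> because they
  are arbitrarily short.
\<close>

lemma null_if_left_dominated: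
  fixes \<mu> \<nu> :: "real measure"
  assumes sets: "sets \<mu> = sets borel" "sets \<nu> = sets borel"
    and fin: "finite_measure \<mu>" "finite_measure \<nu>"
    and E: "E \<in> sets borel" "emeasure \<nu> E = 0"
    and dom: "\<And>t \<delta>. t \<in> E \<Longrightarrow> 0 < \<delta> \<Longrightarrow>
      \<exists>s. t - \<delta> < s \<and> s < t \<and> emeasure \<mu> {s<..t} \<le> emeasure \<nu> {s<..t}"
  shows "emeasure \<mu> E = 0"
proof -
  interpret \<mu>: finite_measure \<mu> by fact
  interpret \<nu>: finite_measure \<nu> by fact
  have "emeasure \<mu> E = (SUP K \<in> {K. K \<subseteq> E \<and> compact K}. emeasure \<mu> K)"
    using sets E \<mu>.emeasure_finite by (intro inner_regular) auto
  also have "\<dots> \<le> (INF U \<in> {U. E \<subseteq> U \<and> open U}. emeasure \<nu> U)"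
  proof (intro SUP_least INF_greatest)
    fix K U assume "K \<in> {K. K \<subseteq> E \<and> compact K}" and "U \<in> {U. E \<subseteq> U \<and> open U}"
    then have K: "K \<subseteq> E" "compact K" and U: "E \<subseteq> U" "open U" by auto
    show "emeasure \<mu> K \<le> emeasure \<nu> U"
    proof (rule compact_left_dominated_le[OF sets K(2)])
      show "U \<in> sets borel" using U(2) by simp
      fix t assume "t \<in> K"
      then have "t \<in> E" "t \<in> U" using K(1) U(1) by auto
      then obtain \<delta> where \<delta>: "0 < \<delta>" "ball t \<delta> \<subseteq> U"
        using U(2) open_contains_ball by blast
      obtain s where "t - \<delta> < s" "s < t" "emeasure \<mu> {s<..t} \<le> emeasure \<nu> {s<..t}"
        using dom[OF \<open>t \<in> E\<close> \<delta>(1)] by blast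
      moreover from this have "{s<..t} \<subseteq> ball t \<delta>"
        by (auto simp: ball_eq_greaterThanLessThan)
      ultimately show "\<exists>s<t. {s<..t} \<subseteq> U \<and> emeasure \<mu> {s<..t} \<le> emeasure \<nu> {s<..t}"
        using \<delta>(2) by blast
    qed
  qed
  also have "\<dots> = emeasure \<nu> E"
    using sets E \<nu>.emeasure_finite by (intro outer_regular[symmetric]) auto
  finally show ?thesis using E(2) by simp
qed

section \<open>Increasing paths and their measures\<close>

text \<open>
  The distribution function behind \<open>stieltjes_kernel\<close>. Because it vanishes at negative times, an
  interval \<open>(s,0]\<close> with \<open>s < 0\<close> has the mass of \<open>{0}\<close>, and time \<open>0\<close> is treated like every other time.
\<close>

definition extended_path :: "real \<Rightarrow> (real \<Rightarrow> 'a \<Rightarrow> real) \<Rightarrow> 'a \<Rightarrow> real \<Rightarrow> real" where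
  "extended_path T V \<omega> t = (if t < 0 then 0 else V (min t T) \<omega>)"

lemma stieltjes_kernel_eq:
  "stieltjes_kernel T V \<omega> = restrict_space (interval_measure (extended_path T V \<omega>)) {0..T}"
  by (simp add: stieltjes_kernel_def extended_path_def[abs_def])

lemma space_stieltjes_kernel: "space (stieltjes_kernel T V \<omega>) = {0..T}"
  by (simp add: stieltjes_kernel_eq space_restrict_space)

lemma sets_stieltjes_kernel:
  "sets (stieltjes_kernel T V \<omega>) = sets (restrict_space borel {0..T})"
  by (simp add: stieltjes_kernel_eq sets_restrict_space)

lemma emeasure_stieltjes_kernel:
  "X \<subseteq> {0..T} \<Longrightarrow>
    emeasure (stieltjes_kernel T V \<omega>) X = emeasure (interval_measure (extended_path T V \<omega>)) X"
  by (simp add: stieltjes_kernel_eq emeasure_restrict_space)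

context
  fixes R :: "'a measure" and T :: real and V :: "real \<Rightarrow> 'a \<Rightarrow> real" and \<omega> :: 'a
  assumes T: "0 \<le> T" and nonneg: "nonneg_process R T V" and incr: "increasing_paths R T V"
    and \<omega>: "\<omega> \<in> space R"
begin

lemma extended_path_mono: "s \<le> t \<Longrightarrow> extended_path T V \<omega> s \<le> extended_path T V \<omega> t"
  using T nonneg incr \<omega>
  by (auto simp: extended_path_def nonneg_process_def increasing_paths_def intro: mono_onD)

lemma extended_path_right_continuous: "continuous (at_right t) (extended_path T V \<omega>)"
proof -
  consider "t < 0" | "0 \<le> t" "t < T" | "0 \<le> t" "T \<le> t" by linarith
  then show ?thesis
  proof cases
    case 1
    have "eventually (\<lambda>s. extended_path T V \<omega> s = 0) (at_right t)"
      using 1 by (auto simp: extended_path_def eventually_at_right_field)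
    then show ?thesis
      using 1 by (simp add: continuous_within extended_path_def tendsto_eventually)
  next
    case 2
    then have "continuous (at_right t) (\<lambda>s. V s \<omega>)"
      using incr \<omega> by (auto simp: increasing_paths_def)
    moreover have "eventually (\<lambda>s. V s \<omega> = extended_path T V \<omega> s) (at_right t)"
      using 2 by (auto simp: extended_path_def eventually_at_right_field intro!: exI[of _ T])
    ultimately show ?thesis
      using 2 by (auto simp: continuous_within extended_path_def elim: Lim_transform_eventually)
  next
    case 3
    have "eventually (\<lambda>s. extended_path T V \<omega> s = V T \<omega>) (at_right t)"
      using 3 by (auto simp: extended_path_def eventually_at_right_field intro!: exI[of _ "t + 1"])
    then show ?thesis
      using 3 by (simp add: continuous_within extended_path_def tendsto_eventually)
  qed
qed

lemma emeasure_path_Ioc: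
  "s \<le> t \<Longrightarrow> emeasure (interval_measure (extended_path T V \<omega>)) {s<..t} =
    ennreal (extended_path T V \<omega> t - extended_path T V \<omega> s)"
  using extended_path_mono extended_path_right_continuous
  by (subst emeasure_interval_measure_Ioc) auto

lemma finite_measure_path: "finite_measure (interval_measure (extended_path T V \<omega>))"
proof
  let ?M = "interval_measure (extended_path T V \<omega>)"
  have "(\<Union>n. {- real n<..real n}) = UNIV"
  proof (intro set_eqI iffI UNIV_I)
    fix x :: real
    obtain n where "\<bar>x\<bar> < real n" using reals_Archimedean2 by blast
    then show "x \<in> (\<Union>n. {- real n<..real n})" by (auto intro!: exI[of _ n])
  qed
  then have "emeasure ?M (space ?M) = (SUP n. emeasure ?M {- real n<..real n})"
    by (subst SUP_emeasure_incseq) (auto simp: incseq_def)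
  also have "\<dots> \<le> ennreal (V T \<omega>)"
  proof (rule SUP_least)
    fix n
    have "extended_path T V \<omega> (real n) - extended_path T V \<omega> (- real n)
        \<le> extended_path T V \<omega> (max (real n) T)"
      using extended_path_mono[of "real n" "max (real n) T"] extended_path_mono[of "-real n - 1" "- real n"]
      by (simp add: extended_path_def)
    also have "\<dots> = V T \<omega>" using T by (auto simp: extended_path_def min_def max_def)
    finally show "emeasure ?M {- real n<..real n} \<le> ennreal (V T \<omega>)"
      by (simp add: emeasure_path_Ioc ennreal_leI)
  qed
  finally show "emeasure ?M (space ?M) \<noteq> \<infinity>" by (auto simp: top_unique)
qed

end

section \<open>Predictability of the set of left rises\<close>

context standard_filtered_prob_space
begin

lemma space_F: "t \<in> {0..T} \<Longrightarrow> space (F t) = space R"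
  using subalgebra_F by (simp add: subalgebra_def)

lemma predictable_generators_Pow:
  "{E \<times> {0} | E. E \<in> sets (F 0)} \<union>
    {E \<times> {s<..t} | E s t. 0 \<le> s \<and> s < t \<and> t \<le> T \<and> E \<in> sets (F s)}
    \<subseteq> Pow (space (F 0) \<times> {0..T})"
proof -
  have "E \<subseteq> space (F 0)" if "E \<in> sets (F s)" "0 \<le> s" "s \<le> T" for E s
    using sets.sets_into_space[OF that(1)] space_F[of s] space_F[of 0] that(2,3) by auto
  then show ?thesis using T_nonneg by fastforce
qed

lemma space_predictable: "space (predictable_algebra T F) = space R \<times> {0..T}"
  unfolding predictable_algebra_def
  by (subst space_measure_of[OF predictable_generators_Pow]) (use space_F[of 0] T_nonneg in auto)

lemma predictable_rectangle:
  assumes "0 \<le> s" "s < T" "E \<in> sets (F s)"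
  shows "E \<times> {s<..T} \<in> sets (predictable_algebra T F)"
  unfolding predictable_algebra_def sets_measure_of[OF predictable_generators_Pow]
  using assms by (intro sigma_sets.Basic) auto

lemma snd_predictable: "snd \<in> borel_measurable (predictable_algebra T F)"
  unfolding borel_measurable_iff_greater
proof
  fix c :: real
  let ?X = "{z \<in> space (predictable_algebra T F). c < snd z}"
  consider "c < 0" | "T \<le> c" | "0 \<le> c" "c < T" by linarith
  then show "?X \<in> sets (predictable_algebra T F)"
  proof cases
    case 1
    then have "?X = space (predictable_algebra T F)" by (auto simp: space_predictable)
    then show ?thesis by (metis sets.top)
  next
    case 2
    then have "?X = {}" by (auto simp: space_predictable)
    then show ?thesis by (metis sets.empty_sets)
  next
    case 3
    then have "?X = space (F c) \<times> {c<..T}"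
      by (auto simp: space_predictable space_F)
    then show ?thesis using 3 predictable_rectangle[of c] by simp
  qed
qed

text \<open>
  A rectangle \<open>E \<times> {u<..v}\<close> has section \<open>E\<close> or \<open>{}\<close> at time \<open>s\<close>, and if the section is \<open>E\<close>, then
  \<open>u < s\<close>, so that \<open>E\<close> belongs to the earlier algebra at time \<open>u\<close>. This is why predictable processes
  are adapted.
\<close>

lemma measurable_time_section:
  assumes s: "s \<in> {0..T}"
  shows "(\<lambda>\<omega>. (\<omega>, s)) \<in> F s \<rightarrow>\<^sub>M predictable_algebra T F"
  unfolding predictable_algebra_def
proof (rule measurable_measure_of[OF predictable_generators_Pow])
  show "(\<lambda>\<omega>. (\<omega>, s)) \<in> space (F s) \<rightarrow> space (F 0) \<times> {0..T}"
    using s space_F T_nonneg by auto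
  fix X assume "X \<in> {E \<times> {0} | E. E \<in> sets (F 0)} \<union>
    {E \<times> {s<..t} | E s t. 0 \<le> s \<and> s < t \<and> t \<le> T \<and> E \<in> sets (F s)}"
  then consider E where "X = E \<times> {0}" "E \<in> sets (F 0)"
    | E u v where "X = E \<times> {u<..v}" "0 \<le> u" "u < v" "v \<le> T" "E \<in> sets (F u)" by blast
  then show "(\<lambda>\<omega>. (\<omega>, s)) -` X \<inter> space (F s) \<in> sets (F s)"
  proof cases
    case 1
    have "E \<in> sets (F s)" using 1(2) mono_F[of 0 s] s by auto
    then show ?thesis using 1(1) by (cases "s = 0") (auto simp: vimage_def)
  next
    case 2
    show ?thesis
    proof (cases "u < s \<and> s \<le> v")
      case True
      then have "E \<in> sets (F s)" using 2 mono_F[of u s] s by auto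
      then show ?thesis using 2(1) True by (auto simp: vimage_def)
    next
      case False
      then have "(\<lambda>\<omega>. (\<omega>, s)) -` X = {}" using 2(1) by auto
      then show ?thesis by simp
    qed
  qed
qed

lemma measurable_path_section:
  assumes \<omega>: "\<omega> \<in> space R"
  shows "Pair \<omega> \<in> restrict_space borel {0..T} \<rightarrow>\<^sub>M predictable_algebra T F"
  unfolding predictable_algebra_def
proof (rule measurable_measure_of[OF predictable_generators_Pow])
  show "Pair \<omega> \<in> space (restrict_space borel {0..T}) \<rightarrow> space (F 0) \<times> {0..T}"
    using \<omega> space_F T_nonneg by (auto simp: space_restrict_space)
  fix X assume "X \<in> {E \<times> {0} | E. E \<in> sets (F 0)} \<union>
    {E \<times> {s<..t} | E s t. 0 \<le> s \<and> s < t \<and> t \<le> T \<and> E \<in> sets (F s)}"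
  then obtain E J where X: "X = E \<times> J" and "J \<in> sets borel" by auto
  then have "J \<inter> {0..T} \<in> sets (restrict_space borel {0..T})"
    by (auto simp: sets_restrict_space)
  moreover have "Pair \<omega> -` X \<inter> space (restrict_space borel {0..T})
      = (if \<omega> \<in> E then J \<inter> {0..T} else {})"
    by (auto simp: X space_restrict_space)
  ultimately show "Pair \<omega> -` X \<inter> space (restrict_space borel {0..T})
      \<in> sets (restrict_space borel {0..T})"
    by simp
qed

text \<open>
  Separating \<open>Y\<^sub>s\<close> from \<open>Y\<^sub>t\<close> by a rational \<open>q\<close> turns the set into a countable union of intersections of
  \<open>{Y\<^sub>s < q} \<times> (s,T]\<close>, a generator of the predictable \<open>\<sigma>\<close>-algebra because \<open>Y\<close> is adapted, with
  \<open>{Y > q}\<close>.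
\<close>

lemma rise_from_fixed_time_predictable:
  assumes Y: "predictable_process T F Y"
  shows "{(\<omega>, t). \<omega> \<in> space R \<and> t \<in> {0..T} \<and> s < t \<and>
      extended_path T Y \<omega> s < extended_path T Y \<omega> t} \<in> sets (predictable_algebra T F)"
    (is "?X \<in> sets ?P")
proof -
  have [measurable]: "(\<lambda>(\<omega>, t). Y t \<omega>) \<in> borel_measurable ?P"
    using Y by (simp add: predictable_process_def)
  consider "s < 0" | "T \<le> s" | "0 \<le> s" "s < T" by linarith
  then show ?thesis
  proof cases
    case 1
    then have "?X = {z \<in> space ?P. 0 < (case z of (\<omega>, t) \<Rightarrow> Y t \<omega>)}"
      by (auto simp: space_predictable extended_path_def)
    also have "\<dots> \<in> sets ?P" by measurable
    finally show ?thesis .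
  next
    case 2
    then have "?X = {}" by auto
    then show ?thesis by (metis sets.empty_sets)
  next
    case 3
    have "(\<lambda>\<omega>. (\<lambda>(\<omega>, t). Y t \<omega>) (\<omega>, s)) \<in> borel_measurable (F s)"
      by (rule measurable_compose[OF measurable_time_section]) (use 3 in auto)
    then have [measurable]: "Y s \<in> borel_measurable (F s)" by simp
    have "{\<omega> \<in> space (F s). Y s \<omega> < q} \<times> {s<..T} \<inter>
        {z \<in> space ?P. q < (case z of (\<omega>, t) \<Rightarrow> Y t \<omega>)} \<in> sets ?P" for q
      using 3 by (intro sets.Int predictable_rectangle) measurable
    then have "(\<Union>q\<in>\<rat>. {\<omega> \<in> space (F s). Y s \<omega> < q} \<times> {s<..T} \<inter>
        {z \<in> space ?P. q < (case z of (\<omega>, t) \<Rightarrow> Y t \<omega>)}) \<in> sets ?P"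
      by (intro sets.countable_UN'' countable_rat)
    also have "(\<Union>q\<in>\<rat>. {\<omega> \<in> space (F s). Y s \<omega> < q} \<times> {s<..T} \<inter>
        {z \<in> space ?P. q < (case z of (\<omega>, t) \<Rightarrow> Y t \<omega>)}) = ?X"
    proof (intro subset_antisym subsetI)
      fix z assume "z \<in> ?X"
      then obtain \<omega> t where z: "z = (\<omega>, t)" "\<omega> \<in> space R" "t \<in> {0..T}" "s < t" "Y s \<omega> < Y t \<omega>"
        using 3 by (auto simp: extended_path_def)
      then obtain q where "q \<in> \<rat>" "Y s \<omega> < q" "q < Y t \<omega>"
        using Rats_dense_in_real by blast
      then show "z \<in> (\<Union>q\<in>\<rat>. {\<omega> \<in> space (F s). Y s \<omega> < q} \<times> {s<..T} \<inter>
          {z \<in> space ?P. q < (case z of (\<omega>, t) \<Rightarrow> Y t \<omega>)})"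
        using 3 z by (intro UN_I[of q]) (auto simp: space_predictable space_F)
    qed (use 3 in \<open>auto simp: space_predictable space_F extended_path_def\<close>)
    finally show ?thesis .
  qed
qed

text \<open>
  Rational \<open>s\<close> make this a countable combination of the sets above. They are dense, which is all that
  differentiation along shrinking intervals \<open>(s,t]\<close> asks for.
\<close>

definition left_rise_set :: "(real \<Rightarrow> 'a \<Rightarrow> real) \<Rightarrow> ('a \<times> real) set" where
  "left_rise_set Y = {(\<omega>, t). \<omega> \<in> space R \<and> t \<in> {0..T} \<and>
     (\<forall>n. \<exists>s\<in>\<rat>. t - 1 / Suc n < s \<and> s < t \<and> extended_path T Y \<omega> s < extended_path T Y \<omega> t)}"

lemma left_rise_set_predictable:
  assumes Y: "predictable_process T F Y"
  shows "left_rise_set Y \<in> sets (predictable_algebra T F)"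
proof -
  let ?P = "predictable_algebra T F"
  let ?X = "\<lambda>s. {(\<omega>, t). \<omega> \<in> space R \<and> t \<in> {0..T} \<and> s < t \<and>
      extended_path T Y \<omega> s < extended_path T Y \<omega> t}"
  have before: "{z \<in> space ?P. snd z < c} \<in> sets ?P" for c :: real
    by (rule borel_measurable_iff_less[THEN iffD1, rule_format, OF snd_predictable])
  have "?X s \<inter> {z \<in> space ?P. snd z < s + 1 / Suc n} \<in> sets ?P" for s n
    by (rule sets.Int[OF rise_from_fixed_time_predictable[OF Y] before])
  then have "(\<Union>s\<in>\<rat>. ?X s \<inter> {z \<in> space ?P. snd z < s + 1 / Suc n}) \<in> sets ?P" for n
    by (rule sets.countable_UN''[OF countable_rat])
  then have "(\<Inter>n. \<Union>s\<in>\<rat>. ?X s \<inter> {z \<in> space ?P. snd z < s + 1 / Suc n}) \<in> sets ?P"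
    by (intro sets.countable_INT image_subsetI UNIV_not_empty)
  also have "(\<Inter>n. \<Union>s\<in>\<rat>. ?X s \<inter> {z \<in> space ?P. snd z < s + 1 / Suc n}) = left_rise_set Y"
  proof -
    have "t - 1 / real (Suc n) < s \<longleftrightarrow> t < s + 1 / real (Suc n)" for s t :: real and n
      by linarith
    then show ?thesis
      by (simp add: left_rise_set_def space_predictable set_eq_iff split_paired_all
          del: of_nat_Suc) blast
  qed
  finally show ?thesis .
qed

lemma left_rise_setD:
  assumes "(\<omega>, t) \<in> left_rise_set Y" "0 < \<delta>"
  shows "\<exists>s. t - \<delta> < s \<and> s < t \<and> extended_path T Y \<omega> s < extended_path T Y \<omega> t"
proof -
  obtain n where "1 / Suc n < \<delta>" using assms(2) by (rule nat_approx_posE)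
  moreover obtain s where "t - 1 / Suc n < s" "s < t" "extended_path T Y \<omega> s < extended_path T Y \<omega> t"
    using assms(1) unfolding left_rise_set_def by blast
  ultimately show ?thesis by (intro exI[of _ s]) linarith
qed

lemma not_left_rise_setD:
  assumes "(\<omega>, t) \<notin> left_rise_set Y" "\<omega> \<in> space R" "t \<in> {0..T}" "0 < \<delta>"
  shows "\<exists>s. t - \<delta> < s \<and> s < t \<and> extended_path T Y \<omega> t \<le> extended_path T Y \<omega> s"
proof -
  obtain n where n: "\<not> (\<exists>s\<in>\<rat>. t - 1 / Suc n < s \<and> s < t \<and>
      extended_path T Y \<omega> s < extended_path T Y \<omega> t)"
    using assms(1-3) unfolding left_rise_set_def by blast
  have "max (t - \<delta>) (t - 1 / Suc n) < t" using assms(4) by simp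
  then obtain s where "s \<in> \<rat>" "max (t - \<delta>) (t - 1 / Suc n) < s" "s < t"
    using Rats_dense_in_real by blast
  moreover from this have "extended_path T Y \<omega> t \<le> extended_path T Y \<omega> s"
    using n by (simp add: not_less del: of_nat_Suc) (meson not_le)
  ultimately show ?thesis by auto
qed

end

section \<open>Predictable separation of singular kernels\<close>

theorem proposition2p24:
  fixes R :: "'a measure" and T :: real and F :: "real \<Rightarrow> 'a measure"
    and A B :: "real \<Rightarrow> 'a \<Rightarrow> real"
  assumes "standard_filtered_prob_space R T F"
    and "nonneg_process R T A" and "increasing_paths R T A" and "predictable_process T F A"
    and "nonneg_process R T B" and "increasing_paths R T B" and "predictable_process T F B"
    and "mutually_singular_kernels R (restrict_space borel {0..T})
           (stieltjes_kernel T A) (stieltjes_kernel T B)"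
  shows "\<exists>C \<in> sets (predictable_algebra T F). AE \<omega> in R.
           sect C \<omega> \<inter> ({0..T} - sect C \<omega>) = {} \<and>
           is_support (stieltjes_kernel T A \<omega>) (sect C \<omega>) \<and>
           is_support (stieltjes_kernel T B \<omega>) ({0..T} - sect C \<omega>)"
proof -
  interpret standard_filtered_prob_space R T F by fact
  define Y where "Y = (\<lambda>t \<omega>. A t \<omega> - B t \<omega>)"
  define C where "C = left_rise_set Y"
  have "(\<lambda>z. (\<lambda>(\<omega>, t). A t \<omega>) z - (\<lambda>(\<omega>, t). B t \<omega>) z) \<in> borel_measurable (predictable_algebra T F)"
    using assms(4,7) unfolding predictable_process_def by (rule borel_measurable_diff)
  then have "predictable_process T F Y"
    by (simp add: predictable_process_def Y_def case_prod_unfold)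
  then have C: "C \<in> sets (predictable_algebra T F)"
    unfolding C_def by (rule left_rise_set_predictable)
  have path_Y: "extended_path T Y \<omega> t = extended_path T A \<omega> t - extended_path T B \<omega> t" for \<omega> t
    by (simp add: extended_path_def Y_def)
  obtain \<Gamma>1 \<Gamma>2 where \<Gamma>: "\<Gamma>1 \<in> sets (R \<Otimes>\<^sub>M restrict_space borel {0..T})"
      "\<Gamma>2 \<in> sets (R \<Otimes>\<^sub>M restrict_space borel {0..T})" "\<Gamma>1 \<inter> \<Gamma>2 = {}"
    and null1: "\<And>\<omega>. \<omega> \<in> space R \<Longrightarrow> emeasure (stieltjes_kernel T A \<omega>) ({0..T} - sect \<Gamma>1 \<omega>) = 0"
    and null2: "\<And>\<omega>. \<omega> \<in> space R \<Longrightarrow> emeasure (stieltjes_kernel T B \<omega>) ({0..T} - sect \<Gamma>2 \<omega>) = 0"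
    using assms(8) unfolding mutually_singular_kernels_def by (auto simp: space_restrict_space)
  have supports: "is_support (stieltjes_kernel T A \<omega>) (sect C \<omega>) \<and>
      is_support (stieltjes_kernel T B \<omega>) ({0..T} - sect C \<omega>)" if \<omega>: "\<omega> \<in> space R" for \<omega>
  proof -
    let ?S = "sets (restrict_space borel {0..T})"
    let ?a = "interval_measure (extended_path T A \<omega>)"
    let ?b = "interval_measure (extended_path T B \<omega>)"
    let ?c = "sect C \<omega>" and ?g1 = "sect \<Gamma>1 \<omega>" and ?g2 = "sect \<Gamma>2 \<omega>"
    have c_sub: "?c \<subseteq> {0..T}" by (auto simp: sect_def C_def left_rise_set_def)
    have "Pair \<omega> -` C \<inter> space (restrict_space borel {0..T}) \<in> ?S"
      using measurable_path_section[OF \<omega>] C by (rule measurable_sets)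
    also have "Pair \<omega> -` C \<inter> space (restrict_space borel {0..T}) = ?c"
      using c_sub by (auto simp: sect_def space_restrict_space)
    finally have c_S: "?c \<in> ?S" .
    have g_S: "?g1 \<in> ?S" "?g2 \<in> ?S"
      using sets_Pair1[OF \<Gamma>(1), of \<omega>] sets_Pair1[OF \<Gamma>(2), of \<omega>] by (auto simp: sect_def vimage_def)
    have borelI: "X \<in> sets borel" "X \<subseteq> {0..T}" if "X \<in> ?S" for X
      using that by (auto simp: sets_restrict_space)
    note [measurable] = borelI(1)[OF c_S] borelI(1)[OF g_S(1)] borelI(1)[OF g_S(2)]
    note g_sub = borelI(2)[OF g_S(1)] borelI(2)[OF g_S(2)]
    have disj: "?g1 \<inter> ?g2 = {}" using \<Gamma>(3) by (auto simp: sect_def)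
    note fin = finite_measure_path[OF T_nonneg assms(2,3) \<omega>] finite_measure_path[OF T_nonneg assms(5,6) \<omega>]
    note Ioc = emeasure_path_Ioc[OF T_nonneg assms(2,3) \<omega>] emeasure_path_Ioc[OF T_nonneg assms(5,6) \<omega>]
    have a0: "emeasure ?a ({0..T} - ?g1) = 0" and b0: "emeasure ?b ({0..T} - ?g2) = 0"
      using null1[OF \<omega>] null2[OF \<omega>] by (auto simp: emeasure_stieltjes_kernel)
    have "emeasure ?a (?g1 - ?c) = 0"
    proof (rule null_if_left_dominated[OF _ _ fin(1) fin(2)])
      have "emeasure ?b (?g1 - ?c) \<le> emeasure ?b ({0..T} - ?g2)"
        using g_sub disj by (intro emeasure_mono) auto
      then show "emeasure ?b (?g1 - ?c) = 0" using b0 by simp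
      fix t \<delta> :: real assume t: "t \<in> ?g1 - ?c" and \<delta>: "0 < \<delta>"
      then have "(\<omega>, t) \<notin> left_rise_set Y" "t \<in> {0..T}"
        using g_sub by (auto simp: sect_def C_def)
      then obtain s where "t - \<delta> < s" "s < t" "extended_path T Y \<omega> t \<le> extended_path T Y \<omega> s"
        using not_left_rise_setD[OF _ \<omega> _ \<delta>] by blast
      then show "\<exists>s. t - \<delta> < s \<and> s < t \<and> emeasure ?a {s<..t} \<le> emeasure ?b {s<..t}"
        by (intro exI[of _ s]) (auto simp: Ioc path_Y intro!: ennreal_leI)
    qed auto
    moreover have "emeasure ?a ({0..T} - ?c) \<le> emeasure ?a (({0..T} - ?g1) \<union> (?g1 - ?c))"
      by (intro emeasure_mono) auto
    moreover have "\<dots> \<le> emeasure ?a ({0..T} - ?g1) + emeasure ?a (?g1 - ?c)"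
      by (intro emeasure_subadditive) auto
    ultimately have a_null: "emeasure ?a ({0..T} - ?c) = 0" using a0 by simp
    have "emeasure ?b (?g2 \<inter> ?c) = 0"
    proof (rule null_if_left_dominated[OF _ _ fin(2) fin(1)])
      have "emeasure ?a (?g2 \<inter> ?c) \<le> emeasure ?a ({0..T} - ?g1)"
        using g_sub disj by (intro emeasure_mono) auto
      then show "emeasure ?a (?g2 \<inter> ?c) = 0" using a0 by simp
      fix t \<delta> :: real assume t: "t \<in> ?g2 \<inter> ?c" and \<delta>: "0 < \<delta>"
      then have "(\<omega>, t) \<in> left_rise_set Y" by (auto simp: sect_def C_def)
      then obtain s where "t - \<delta> < s" "s < t" "extended_path T Y \<omega> s < extended_path T Y \<omega> t"
        using left_rise_setD \<delta> by blast
      then show "\<exists>s. t - \<delta> < s \<and> s < t \<and> emeasure ?b {s<..t} \<le> emeasure ?a {s<..t}"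
        by (intro exI[of _ s]) (auto simp: Ioc path_Y intro!: ennreal_leI)
    qed auto
    moreover have "emeasure ?b ?c \<le> emeasure ?b (({0..T} - ?g2) \<union> (?g2 \<inter> ?c))"
      using c_sub by (intro emeasure_mono) auto
    moreover have "\<dots> \<le> emeasure ?b ({0..T} - ?g2) + emeasure ?b (?g2 \<inter> ?c)"
      by (intro emeasure_subadditive) auto
    ultimately have b_null: "emeasure ?b ?c = 0" using b0 by simp
    have "{0..T} - ?c \<in> ?S"
      using sets.compl_sets[OF c_S] by (simp add: space_restrict_space)
    moreover have "{0..T} - ({0..T} - ?c) = ?c" using c_sub by auto
    ultimately show ?thesis
      using c_S a_null b_null c_sub
      by (simp add: is_support_def sets_stieltjes_kernel space_stieltjes_kernel
          emeasure_stieltjes_kernel)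
  qed
  show ?thesis
    by (intro bexI[OF _ C] AE_I2) (use supports in auto)
qed

end
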